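(* Let $n$ be a positive integer, let $X_1,\ldots,X_n$ be indicator (i.e. $\{0,1\}$-valued) random variables on a common probability space (no independence is assumed), let $\beta$ be a real number with $0<\beta<1$, and let $k$ be an integer with $0<k<\beta n$. Then $$ \Pr\left(\sum_{i=1}^n X_i\geq \beta n\right)\leq \frac{1}{\binom{\beta n}{k}}\sum_{S\subseteq\{1,\ldots,n\},\ |S|=k}\Pr\left(\bigwedge_{i\in S}(X_i=1)\right). $$ In particular, if $\alpha$ is a real number with $0<\alpha<\beta$ such that $k=\left(\frac{\beta-\alpha}{1-\alpha}\right)n$ is an integer, and if $$ \Pr\left(\bigwedge_{i\in S}(X_i=1)\right)\leq \alpha^k $$ for every $S\subseteq\{1,\ldots,n\}$ of size $k=\left(\frac{\beta-\alpha}{1-\alpha}\right)n$, then $$ \Pr\left(\sum_{i=1}^n X_i\geq \beta n\right)\leq e^{-D(\beta\|\alpha)\,n}. $$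
   Context: The number $\beta n$ need not be an integer. For real $x$ and a positive integer $k$, $\binom{x}{k}=\frac{x(x-1)\cdots(x-k+1)}{k!}$ is the generalized binomial coefficient. For $0<\alpha,\beta<1$, $D(\beta\|\alpha)=\beta\ln\frac{\beta}{\alpha}+(1-\beta)\ln\frac{1-\beta}{1-\alpha}$ is the relative entropy (Kullback–Leibler divergence) between Bernoulli distributions with parameters $\beta$ and $\alpha$, with natural logarithms. *)

theory Defs
  imports "HOL-Probability.Probability"
begin

definition bernoulli_KL :: "real \<Rightarrow> real \<Rightarrow> real" where
  "bernoulli_KL \<beta> \<alpha> = \<beta> * ln (\<beta> / \<alpha>) + (1 - \<beta>) * ln ((1 - \<beta>) / (1 - \<alpha>))"

end

theory Submission
  imports Defs
begin

text \<open>
  The first bound is Markov's inequality for the number of \<open>k\<close>-subsets of the random set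
  \<open>{i. X i = 1}\<close>, since this number is at least the binomial coefficient of \<open>\<beta> n\<close> over \<open>k\<close>
  whenever the set has at least \<open>\<beta> n\<close> elements.  For the second bound, the quotient of the
  two binomial coefficients times \<open>\<alpha> ^ k\<close> is the product over \<open>i < k\<close> of
  \<open>\<alpha> (n - i) / (\<beta> n - i)\<close>.  The logarithms of the factors increase with \<open>i\<close>, so their sum is at
  most the integral from \<open>0\<close> to \<open>k\<close>, which for the given \<open>k\<close> equals minus the relative
  entropy times \<open>n\<close>.
\<close>

text \<open>For positive \<open>k\<close> the hypothesis says that the smallest numerator factor,
  \<open>x - (k - 1)\<close>, is positive; hence so are all the others.\<close>

lemma gbinomial_pos_real:
  fixes x :: real
  assumes "real k < x + 1"
  shows "x gchoose k > 0"
  unfolding gbinomial_prod_rev using assms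
  by (intro divide_pos_pos prod_pos) auto

text \<open>The numerator factors of the smaller side are positive, so the products can be compared
  factor by factor.\<close>

lemma gbinomial_mono_real:
  fixes x y :: real
  assumes "real k < x + 1" and "x \<le> y"
  shows "x gchoose k \<le> y gchoose k"
  unfolding gbinomial_prod_rev using assms
  by (intro divide_right_mono prod_mono) auto

lemma (in prob_space) prob_sum_indicators_ge_le:
  fixes X :: "'i \<Rightarrow> 'a \<Rightarrow> real"
  assumes fin: "finite I"
    and meas: "\<And>i. i \<in> I \<Longrightarrow> X i \<in> borel_measurable M"
    and ind: "\<And>i \<omega>. i \<in> I \<Longrightarrow> \<omega> \<in> space M \<Longrightarrow> X i \<omega> \<in> {0, 1}"
    and k: "real k < t + 1"
  shows "\<P>(\<omega> in M. (\<Sum>i\<in>I. X i \<omega>) \<ge> t)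
    \<le> 1 / (t gchoose k) * (\<Sum>S | S \<subseteq> I \<and> card S = k. \<P>(\<omega> in M. \<forall>i\<in>S. X i \<omega> = 1))"
proof -
  define E where "E S = {\<omega> \<in> space M. \<forall>i\<in>S. X i \<omega> = 1}" for S
  define F where "F = {\<omega> \<in> space M. (\<Sum>i\<in>I. X i \<omega>) \<ge> t}"
  define A where "A = {S. S \<subseteq> I \<and> card S = k}"
  have finA: "finite A"
    unfolding A_def using fin by simp
  have E: "E S \<in> events" if "S \<in> A" for S
  proof -
    have "finite S" "\<And>i. i \<in> S \<Longrightarrow> X i \<in> borel_measurable M"
      using that meas fin by (auto simp: A_def intro: finite_subset)
    then show ?thesis
      unfolding E_def by measurable
  qed
  have F: "F \<in> events"
    unfolding F_def using meas by measurable
  have pos: "t gchoose k > 0"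
    using k by (rule gbinomial_pos_real)
  \<comment> \<open>This is the pointwise inequality behind Markov's bound: the right side counts
    the \<open>k\<close>-subsets whose event occurs at \<open>\<omega>\<close>. Outside
    \<open>F\<close> the left side is zero.\<close>
  have pointwise: "(t gchoose k) * indicator F \<omega> \<le> (\<Sum>S\<in>A. indicator (E S) \<omega> :: real)"
    if w: "\<omega> \<in> space M" for \<omega>
  proof (cases "\<omega> \<in> F")
    case True
    define J where "J = {i \<in> I. X i \<omega> = 1}"
    have finJ: "finite J"
      using fin by (simp add: J_def)
    have "(\<Sum>i\<in>I. X i \<omega>) = (\<Sum>i\<in>I. if X i \<omega> = 1 then 1 else 0)"
      using ind w by (intro sum.cong) auto
    also have "\<dots> = real (card J)"
      using fin by (simp add: J_def sum.If_cases Int_def)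
    finally have "t \<le> real (card J)"
      using True by (simp add: F_def)
    then have "t gchoose k \<le> real (card J) gchoose k"
      by (rule gbinomial_mono_real[OF k])
    also have "\<dots> = real (card J choose k)"
      by (simp add: binomial_gbinomial)
    also have "\<dots> = real (card {S. S \<subseteq> J \<and> card S = k})"
      using finJ by (simp add: n_subsets)
    \<comment> \<open>The event of a \<open>k\<close>-subset of \<open>I\<close> occurs at
      \<open>\<omega>\<close> exactly when the subset lies inside \<open>J\<close>, so both sides
      count the same sets.\<close>
    also have "{S. S \<subseteq> J \<and> card S = k} = {S \<in> A. \<omega> \<in> E S}"
      using w by (auto simp: J_def A_def E_def)
    also have "real (card {S \<in> A. \<omega> \<in> E S}) = (\<Sum>S\<in>A. indicator (E S) \<omega>)"
      using finA by (simp add: indicator_def sum.If_cases Int_def)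
    finally show ?thesis
      using True by simp
  qed (simp add: sum_nonneg)
  have "(t gchoose k) * prob F = expectation (\<lambda>\<omega>. (t gchoose k) * indicator F \<omega>)"
    using F by simp
  also have "\<dots> \<le> expectation (\<lambda>\<omega>. \<Sum>S\<in>A. indicator (E S) \<omega>)"
    using E F pointwise
    by (intro integral_mono integrable_mult_right Bochner_Integration.integrable_sum
        integrable_real_indicator) (auto simp: less_top[symmetric])
  also have "\<dots> = (\<Sum>S\<in>A. prob (E S))"
    using E by (subst Bochner_Integration.integral_sum)
      (auto intro!: integrable_real_indicator simp: less_top[symmetric])
  finally show ?thesis
    using pos unfolding F_def[symmetric] E_def[symmetric] A_def[symmetric]
    by (simp add: field_simps)
qed

text \<open>Comparison of a sum with an integral, phrased through an antiderivative. On each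
  interval from \<open>i\<close> to \<open>i + 1\<close> the mean value theorem gives the increment
  of \<open>F\<close> as some \<open>f z\<close> with \<open>z > i\<close>, which is at least
  \<open>f i\<close>; the increments then telescope.\<close>

lemma sum_le_antiderivative_diff:
  fixes f F :: "real \<Rightarrow> real"
  assumes deriv: "\<And>x. 0 \<le> x \<Longrightarrow> x \<le> real k \<Longrightarrow> (F has_real_derivative f x) (at x)"
    and mono: "\<And>x y. 0 \<le> x \<Longrightarrow> x \<le> y \<Longrightarrow> y \<le> real k \<Longrightarrow> f x \<le> f y"
  shows "(\<Sum>i<k. f (real i)) \<le> F (real k) - F 0"
proof -
  have step: "f (real i) \<le> F (real (Suc i)) - F (real i)" if i: "i < k" for i
  proof -
    have "\<exists>z>real i. z < real (Suc i) \<and>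
        F (real (Suc i)) - F (real i) = (real (Suc i) - real i) * f z"
      using i by (intro MVT2 deriv) auto
    then obtain z where z: "real i < z" "z < real (Suc i)"
        "F (real (Suc i)) - F (real i) = f z"
      by auto
    moreover have "f (real i) \<le> f z"
      using z i by (intro mono) auto
    ultimately show ?thesis
      by simp
  qed
  have "(\<Sum>i<k. f (real i)) \<le> (\<Sum>i<k. F (real (Suc i)) - F (real i))"
    using step by (intro sum_mono) auto
  also have "\<dots> = F (real k) - F 0"
    by (subst sum_lessThan_telescope) simp
  finally show ?thesis .
qed

lemma binomial_quotient_le_exp_KL:
  fixes \<alpha> \<beta> :: real
  assumes n: "n > 0" and \<alpha>: "0 < \<alpha>" "\<alpha> < \<beta>" and \<beta>: "\<beta> < 1"
    and k: "real k = (\<beta> - \<alpha>) / (1 - \<alpha>) * real n"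
  shows "real (n choose k) * \<alpha> ^ k / ((\<beta> * real n) gchoose k) \<le> exp (- bernoulli_KL \<beta> \<alpha> * real n)"
proof -
  \<comment> \<open>Here \<open>r\<close> is the fraction \<open>1 - k / N\<close>. At
    \<open>x = k\<close> the quotient \<open>\<alpha> (N - x) / (\<beta> N - x)\<close> equals 1, so
    this \<open>k\<close> is the point where the increasing factors reach 1.\<close>
  define N r where "N = real n" and "r = (1 - \<beta>) / (1 - \<alpha>)"
  have N: "N > 0" and r: "r > 0"
    using assms by (simp_all add: N_def r_def)
  have nk: "N - real k = N * r"
    using \<alpha> \<beta> by (simp add: k N_def r_def field_simps)
  have bk: "\<beta> * N - real k = \<alpha> * (N * r)"
    using \<alpha> \<beta> by (simp add: k N_def r_def field_simps)
  have Nr: "0 < N * r" "0 < \<alpha> * (N * r)"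
    using N r \<alpha> by auto
  define f where "f x = ln (\<alpha> * (N - x) / (\<beta> * N - x))" for x
  \<comment> \<open>An antiderivative of \<open>f\<close>: differentiating the two products of the
    form \<open>u ln u\<close> also yields constants -1 and +1, which cancel.\<close>
  define F where "F x = (\<beta> * N - x) * ln (\<beta> * N - x) - (N - x) * ln (N - x) + x * ln \<alpha>" for x
  \<comment> \<open>Both differences decrease in \<open>x\<close> and are still positive at
    \<open>x = k\<close>, so every logarithm below has a positive argument.\<close>
  have gap: "0 < N - x" "0 < \<beta> * N - x" if "x \<le> real k" for x
    using nk bk Nr that by linarith+
  have deriv: "(F has_real_derivative f x) (at x)" if "x \<le> real k" for x
    unfolding F_def f_def using gap[OF that] \<alpha>
    by (auto intro!: derivative_eq_intros simp: ln_mult ln_div)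
  have mono: "f x \<le> f y" if "x \<le> y" "y \<le> real k" for x y
  proof -
    have g: "0 < N - x" "0 < \<beta> * N - x" "0 < N - y" "0 < \<beta> * N - y"
      using gap that by auto
    \<comment> \<open>This product is exactly the difference of the two cross products compared
      next.\<close>
    have "0 \<le> (y - x) * ((1 - \<beta>) * N)"
      using that \<beta> N by auto
    then have "(N - x) * (\<beta> * N - y) \<le> (N - y) * (\<beta> * N - x)"
      by (simp add: algebra_simps)
    then have "(N - x) / (\<beta> * N - x) \<le> (N - y) / (\<beta> * N - y)"
      using g by (simp add: divide_simps)
    then have "\<alpha> * ((N - x) / (\<beta> * N - x)) \<le> \<alpha> * ((N - y) / (\<beta> * N - y))"
      using \<alpha> by (intro mult_left_mono) auto
    then show ?thesis
      unfolding f_def using g \<alpha> by (intro iffD2[OF ln_le_cancel_iff]) auto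
  qed
  \<comment> \<open>The factorials of the two binomial coefficients cancel, and one factor
    \<open>\<alpha>\<close> goes to each quotient.\<close>
  have "real (n choose k) * \<alpha> ^ k / ((\<beta> * real n) gchoose k)
      = (\<Prod>i<k. \<alpha> * (N - real i) / (\<beta> * N - real i))"
    by (simp add: binomial_gbinomial gbinomial_prod_rev N_def prod.distrib prod_dividef
        atLeast0LessThan)
  also have "\<dots> = (\<Prod>i<k. exp (f (real i)))"
    using gap \<alpha> by (intro prod.cong) (auto simp: f_def)
  also have "\<dots> = exp (\<Sum>i<k. f (real i))"
    by (simp add: exp_sum)
  also have "\<dots> \<le> exp (F (real k) - F 0)"
    using sum_le_antiderivative_diff[of k F f] deriv mono by simp
  also have "F (real k) - F 0 = - bernoulli_KL \<beta> \<alpha> * real n"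
  proof -
    have k': "real k = N - N * r"
      using nk by simp
    have "\<beta> * N - N = \<alpha> * (N * r) - N * r"
      using nk bk by linarith
    \<comment> \<open>Eliminating the product \<open>\<beta> * N\<close> turns the final claim into
      an identity linear in the logarithms of \<open>\<alpha>\<close>, \<open>\<beta>\<close>,
      \<open>N\<close> and \<open>r\<close>, with polynomial coefficients that can be compared
      directly.\<close>
    then have \<beta>': "\<beta> * N = N + \<alpha> * (N * r) - N * r"
      by simp
    have KL: "bernoulli_KL \<beta> \<alpha> = \<beta> * (ln \<beta> - ln \<alpha>) + (1 - \<beta>) * ln r"
      using \<alpha> \<beta> by (simp add: bernoulli_KL_def r_def ln_div)
    have "bernoulli_KL \<beta> \<alpha> * N = (\<beta> * N) * (ln \<beta> - ln \<alpha>) + (N - \<beta> * N) * ln r"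
      unfolding KL by (simp add: algebra_simps)
    moreover have "F (real k) - F 0 = \<alpha> * (N * r) * (ln \<alpha> + (ln N + ln r))
        - N * r * (ln N + ln r) + (N - N * r) * ln \<alpha> - (\<beta> * N) * (ln \<beta> + ln N) + N * ln N"
      unfolding F_def nk bk using \<alpha> \<beta> N r by (simp add: ln_mult k')
    ultimately show ?thesis
      unfolding N_def[symmetric] \<beta>' by (simp add: algebra_simps)
  qed
  finally show ?thesis .
qed

theorem mainTheorem1:
  fixes M :: "'a measure" and X :: "nat \<Rightarrow> 'a \<Rightarrow> real" and n :: nat and \<beta> :: real
  assumes "prob_space M"
    and "n > 0"
    and "\<And>i. i \<in> {1..n} \<Longrightarrow> X i \<in> borel_measurable M"
    and "\<And>i \<omega>. i \<in> {1..n} \<Longrightarrow> \<omega> \<in> space M \<Longrightarrow> X i \<omega> \<in> {0, 1}"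
    and "0 < \<beta>" and "\<beta> < 1"
  shows
    "(\<forall>k::nat. 0 < k \<and> real k < \<beta> * real n \<longrightarrow>
        \<P>(\<omega> in M. (\<Sum>i=1..n. X i \<omega>) \<ge> \<beta> * real n)
          \<le> 1 / ((\<beta> * real n) gchoose k) *
             (\<Sum>S | S \<subseteq> {1..n} \<and> card S = k. \<P>(\<omega> in M. \<forall>i\<in>S. X i \<omega> = 1)))
     \<and> (\<forall>(\<alpha>::real) (k::nat).
        0 < \<alpha> \<and> \<alpha> < \<beta> \<and> real k = (\<beta> - \<alpha>) / (1 - \<alpha>) * real n \<and>
        (\<forall>S. S \<subseteq> {1..n} \<and> card S = k \<longrightarrow> \<P>(\<omega> in M. \<forall>i\<in>S. X i \<omega> = 1) \<le> \<alpha> ^ k) \<longrightarrow>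
        \<P>(\<omega> in M. (\<Sum>i=1..n. X i \<omega>) \<ge> \<beta> * real n) \<le> exp (- bernoulli_KL \<beta> \<alpha> * real n))"
proof (intro conjI allI impI)
  interpret prob_space M
    by fact
  have tail: "\<P>(\<omega> in M. (\<Sum>i=1..n. X i \<omega>) \<ge> \<beta> * real n)
      \<le> 1 / ((\<beta> * real n) gchoose k) *
         (\<Sum>S | S \<subseteq> {1..n} \<and> card S = k. \<P>(\<omega> in M. \<forall>i\<in>S. X i \<omega> = 1))"
    if "real k < \<beta> * real n" for k
    using assms that by (intro prob_sum_indicators_ge_le) auto
  {
    fix k :: nat
    assume "0 < k \<and> real k < \<beta> * real n"
    then show "\<P>(\<omega> in M. (\<Sum>i=1..n. X i \<omega>) \<ge> \<beta> * real n)
        \<le> 1 / ((\<beta> * real n) gchoose k) *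
           (\<Sum>S | S \<subseteq> {1..n} \<and> card S = k. \<P>(\<omega> in M. \<forall>i\<in>S. X i \<omega> = 1))"
      using tail by blast
  next
    fix \<alpha> :: real and k :: nat
    assume *: "0 < \<alpha> \<and> \<alpha> < \<beta> \<and> real k = (\<beta> - \<alpha>) / (1 - \<alpha>) * real n \<and>
      (\<forall>S. S \<subseteq> {1..n} \<and> card S = k \<longrightarrow> \<P>(\<omega> in M. \<forall>i\<in>S. X i \<omega> = 1) \<le> \<alpha> ^ k)"
    \<comment> \<open>Clearing the denominator in
      \<open>(\<beta> - \<alpha>) / (1 - \<alpha>) < \<beta>\<close> leaves this inequality; it puts
      \<open>k\<close> below \<open>\<beta> n\<close>, so the first bound applies.\<close>
    have "0 < \<alpha> * (1 - \<beta>)"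
      using * assms by simp
    then have "(\<beta> - \<alpha>) / (1 - \<alpha>) < \<beta>"
      using * assms by (simp add: divide_simps algebra_simps)
    then have k: "real k < \<beta> * real n"
      using mult_strict_right_mono[of "(\<beta> - \<alpha>) / (1 - \<alpha>)" \<beta> "real n"] * assms by simp
    have pos: "(\<beta> * real n) gchoose k > 0"
      using k by (intro gbinomial_pos_real) simp
    have "(\<Sum>S | S \<subseteq> {1..n} \<and> card S = k. \<P>(\<omega> in M. \<forall>i\<in>S. X i \<omega> = 1))
        \<le> of_nat (card {S. S \<subseteq> {1..n} \<and> card S = k}) * \<alpha> ^ k"
      using * by (intro sum_bounded_above) auto
    also have "\<dots> = real (n choose k) * \<alpha> ^ k"
      by (simp add: n_subsets)
    finally have "1 / ((\<beta> * real n) gchoose k) *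
         (\<Sum>S | S \<subseteq> {1..n} \<and> card S = k. \<P>(\<omega> in M. \<forall>i\<in>S. X i \<omega> = 1))
        \<le> 1 / ((\<beta> * real n) gchoose k) * (real (n choose k) * \<alpha> ^ k)"
      using pos by (intro mult_left_mono) auto
    also have "\<dots> \<le> exp (- bernoulli_KL \<beta> \<alpha> * real n)"
      using binomial_quotient_le_exp_KL[of n \<alpha> \<beta> k] * assms by simp
    finally show "\<P>(\<omega> in M. (\<Sum>i=1..n. X i \<omega>) \<ge> \<beta> * real n) \<le> exp (- bernoulli_KL \<beta> \<alpha> * real n)"
      using tail[OF k] by linarith
  }
qed

end
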